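(* Let $V$ be a vector space over a field $F$ and let $P, Q \colon V \to V$ be projectors. The following statements are equivalent: (i) The composition $PQ$ is a projector. (ii) $\operatorname{Im} P \cap (\operatorname{Im} Q + \operatorname{Ker} P) \leq \operatorname{Im} Q \oplus (\operatorname{Ker} P \cap \operatorname{Ker} Q)$. (iii) $\operatorname{Im} Q \leq \operatorname{Im} P \oplus (\operatorname{Ker} P \cap \operatorname{Im} Q) \oplus (\operatorname{Ker} P \cap \operatorname{Ker} Q)$. (iv) $\operatorname{Ker} Q \oplus (\operatorname{Ker} P \cap \operatorname{Im} Q) \geq \operatorname{Ker} P \cap (\operatorname{Im} Q + \operatorname{Im} P)$. (v) $\operatorname{Ker} P \geq \operatorname{Ker} Q \cap (\operatorname{Im} Q + \operatorname{Ker} P) \cap (\operatorname{Im} Q + \operatorname{Im} P)$.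
   Context: Vector spaces are arbitrary (possibly infinite-dimensional). A projector on $V$ is a linear map $P\colon V\to V$ with $P^2=P$. For subspaces, $V_1 \leq V_2$ (equivalently $V_2\geq V_1$) means that $V_1$ is contained in $V_2$, and $\oplus$ denotes a sum of subspaces that is direct. *)

theory Defs
  imports Complex_Main "HOL-Library.Set_Algebras"
begin

definition projector ::
    "('a::field \<Rightarrow> 'b::ab_group_add \<Rightarrow> 'b) \<Rightarrow> ('b \<Rightarrow> 'b) \<Rightarrow> bool" where
  "projector scale P \<longleftrightarrow> Vector_Spaces.linear scale scale P \<and> P \<circ> P = P"

definition ker :: "('b \<Rightarrow> 'c::zero) \<Rightarrow> 'b set" where
  "ker f = {x. f x = 0}"

text \<open>
  The sum of the listed subspaces is direct: distinct choices of summands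
  have distinct sums. The sum itself is the elementwise \<open>+\<close> on sets, so
  the assertion \<open>W = U1 \<oplus> U2\<close> amounts to \<open>direct [U1, U2]\<close>
  together with \<open>W = U1 + U2\<close>.
\<close>

definition direct :: "'b::monoid_add set list \<Rightarrow> bool" where
  "direct Us \<longleftrightarrow> inj_on sum_list (listset Us)"

end

theory Submission
  imports Defs
begin

text \<open>
  Since \<open>P \<circ> Q\<close> is always linear, (i) says that \<open>P Q P Q = P Q\<close>. Three of the subspaces
  in (ii), (iv), (v) have simple parametrizations: \<open>Im P \<inter> (Im Q + Ker P) = Im (P Q)\<close>,
  \<open>Ker P \<inter> (Im Q + Im P) = {q - P q | q \<in> Im Q}\<close>, and the triple intersection in (v) is
  \<open>{y - Q y | y \<in> Im (P Q)}\<close>. Each equivalence then follows by applying \<open>P\<close> and \<open>Q\<close> to a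
  decomposition, or by splitting a vector \<open>v\<close> as \<open>Q v + (v - Q v)\<close>.
\<close>

lemma direct_pairI:
  assumes "\<And>a a' b b'. \<lbrakk>a \<in> A; a' \<in> A; b \<in> B; b' \<in> B; a + b = a' + b'\<rbrakk>
    \<Longrightarrow> a = a' \<and> b = b'"
  shows "direct [A, B]"
  unfolding direct_def by (rule inj_onI) (auto simp: set_Cons_def dest: assms)

text \<open>The premise brackets sums to the left, as the threefold set sum does, while
  \<open>sum_list\<close> brackets to the right; associativity bridges the two.\<close>

lemma direct_tripleI:
  assumes "\<And>a a' b b' c c'. \<lbrakk>a \<in> A; a' \<in> A; b \<in> B; b' \<in> B; c \<in> C; c' \<in> C;
    a + b + c = a' + b' + c'\<rbrakk> \<Longrightarrow> a = a' \<and> b = b' \<and> c = c'"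
  shows "direct [A, B, C]"
  unfolding direct_def
proof (rule inj_onI)
  fix xs ys assume xs: "xs \<in> listset [A, B, C]" and ys: "ys \<in> listset [A, B, C]"
    and eq: "sum_list xs = sum_list ys"
  obtain a b c where "xs = [a, b, c]" "a \<in> A" "b \<in> B" "c \<in> C"
    using xs by (auto simp: set_Cons_def)
  moreover obtain a' b' c' where "ys = [a', b', c']" "a' \<in> A" "b' \<in> B" "c' \<in> C"
    using ys by (auto simp: set_Cons_def)
  ultimately show "xs = ys"
    using assms[of a a' b b' c c'] eq by (simp add: add.assoc)
qed

lemma mem_ker: "x \<in> ker f \<longleftrightarrow> f x = 0"
  by (simp add: ker_def)

text \<open>Isolates additivity and idempotence, so that \<open>scale\<close> enters only through
  \<open>projector_additive\<close> and \<open>projector_comp_iff\<close>.\<close>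

locale additive_idempotents = P: additive P + Q: additive Q
  for P Q :: "'b::ab_group_add \<Rightarrow> 'b" +
  assumes P_idem [simp]: "P (P x) = P x"
    and Q_idem [simp]: "Q (Q x) = Q x"
begin

lemmas hom_simps = P.add P.diff P.minus P.zero Q.add Q.diff Q.minus Q.zero

lemma range_P: "range P = {x. P x = x}"
  by (auto intro: range_eqI[OF sym])

lemma range_Q: "range Q = {x. Q x = x}"
  by (auto intro: range_eqI[OF sym])

lemmas subspace_simps = range_P range_Q ker_def

text \<open>\<open>Q\<close> fixes the first summand and kills the second, so it reads the first off
  the sum.\<close>

lemma direct_rangeQ_kers: "direct [range Q, ker P \<inter> ker Q]"
proof (rule direct_pairI)
  fix a a' b b'
  assume mem: "a \<in> range Q" "a' \<in> range Q" "b \<in> ker P \<inter> ker Q" "b' \<in> ker P \<inter> ker Q"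
    and eq: "a + b = a' + b'"
  have "a = a'"
    using mem arg_cong[OF eq, of Q] by (simp add: subspace_simps hom_simps)
  with eq show "a = a' \<and> b = b'" by simp
qed

lemma direct_kerQ_inter: "direct [ker Q, ker P \<inter> range Q]"
proof (rule direct_pairI)
  fix a a' b b'
  assume mem: "a \<in> ker Q" "a' \<in> ker Q" "b \<in> ker P \<inter> range Q" "b' \<in> ker P \<inter> range Q"
    and eq: "a + b = a' + b'"
  have "b = b'"
    using mem arg_cong[OF eq, of Q] by (simp add: subspace_simps hom_simps)
  with eq show "a = a' \<and> b = b'" by simp
qed

text \<open>\<open>P\<close> reads off the first summand; \<open>Q\<close> then separates the other
  two.\<close>

lemma direct_rangeP_inter_kers: "direct [range P, ker P \<inter> range Q, ker P \<inter> ker Q]"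
proof (rule direct_tripleI)
  fix a a' b b' c c'
  assume mem: "a \<in> range P" "a' \<in> range P" "b \<in> ker P \<inter> range Q" "b' \<in> ker P \<inter> range Q"
      "c \<in> ker P \<inter> ker Q" "c' \<in> ker P \<inter> ker Q"
    and eq: "a + b + c = a' + b' + c'"
  have a: "a = a'"
    using mem arg_cong[OF eq, of P] by (simp add: subspace_simps hom_simps)
  with eq have eq': "b + c = b' + c'" by (simp add: add.assoc)
  have "b = b'"
    using mem arg_cong[OF eq', of Q] by (simp add: subspace_simps hom_simps)
  with a eq' show "a = a' \<and> b = b' \<and> c = c'" by simp
qed

text \<open>If \<open>y = q + k\<close> is fixed by \<open>P\<close>, then
  \<open>y = P y = P q\<close>. Conversely, \<open>P (Q z)\<close> differs from \<open>Q z\<close>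
  by an element of \<open>ker P\<close>.\<close>

lemma rangeP_inter_eq: "range P \<inter> (range Q + ker P) = range (P \<circ> Q)"
proof (intro equalityI subsetI)
  fix y assume "y \<in> range P \<inter> (range Q + ker P)"
  then obtain q k where "P y = y" "Q q = q" "P k = 0" "y = q + k"
    by (auto simp: subspace_simps elim!: set_plus_elim)
  then have "y = (P \<circ> Q) q" by (metis P.add add.right_neutral comp_apply)
  then show "y \<in> range (P \<circ> Q)" by blast
next
  fix y assume "y \<in> range (P \<circ> Q)"
  then obtain z where y: "y = P (Q z)" by auto
  have "Q z + (P (Q z) - Q z) \<in> range Q + ker P"
    by (rule set_plus_intro) (auto simp: mem_ker hom_simps)
  with y show "y \<in> range P \<inter> (range Q + ker P)" by simp
qed

text \<open>Applying \<open>P\<close> to \<open>y = q + p\<close> with \<open>P y = 0\<close> forces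
  \<open>p = - P q\<close>.\<close>

lemma kerP_inter_eq: "ker P \<inter> (range Q + range P) = (\<lambda>q. q - P q) ` range Q"
proof (intro equalityI subsetI)
  fix y assume "y \<in> ker P \<inter> (range Q + range P)"
  then obtain q p where y: "P y = 0" "q \<in> range Q" "P p = p" "y = q + p"
    by (auto simp: subspace_simps elim!: set_plus_elim)
  then have "P q + p = 0" by (metis P.add)
  then have "y = q - P q" using y(4) by (simp add: eq_neg_iff_add_eq_0 add.commute)
  with y(2) show "y \<in> (\<lambda>q. q - P q) ` range Q" by blast
next
  fix y assume "y \<in> (\<lambda>q. q - P q) ` range Q"
  then obtain q where q: "q \<in> range Q" "y = q + P (- q)" by (auto simp: hom_simps)
  then have "y \<in> range Q + range P" by (metis rangeI set_plus_intro)
  with q show "y \<in> ker P \<inter> (range Q + range P)" by (simp add: mem_ker hom_simps)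
qed

lemma kerQ_inter_eq:
  "ker Q \<inter> (range Q + ker P) \<inter> (range Q + range P) = (\<lambda>y. y - Q y) ` range (P \<circ> Q)"
proof (intro equalityI subsetI)
  fix x assume mem: "x \<in> ker Q \<inter> (range Q + ker P) \<inter> (range Q + range P)"
  obtain q k where qk: "Q q = q" "P k = 0" "x = q + k"
    using mem by (auto simp: mem_ker range_Q elim: set_plus_elim)
  obtain q' p where q'p: "Q q' = q'" "P p = p" "x = q' + p"
    using mem by (auto simp: range_P range_Q elim: set_plus_elim)
  \<comment> \<open>Since \<open>Q x = 0\<close>, this determines \<open>q'\<close> as
    \<open>- Q p\<close>.\<close>
  have "q' + Q p = 0" using mem arg_cong[OF q'p(3), of Q] q'p(1) by (simp add: mem_ker hom_simps)
  then have "x = p - Q p" using q'p(3) by (metis add_eq_0_iff2 add.commute diff_conv_add_uminus)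
  \<comment> \<open>Equate the two decompositions of \<open>x\<close> and apply \<open>P\<close>,
    which kills \<open>k\<close> and fixes \<open>p\<close>.\<close>
  moreover have "P q = P q' + p"
    using arg_cong[OF trans[OF sym[OF qk(3)] q'p(3)], of P] qk(2) q'p(2) by (simp add: hom_simps)
  then have "p = P (q - q')" by (simp add: hom_simps)
  then have "p = (P \<circ> Q) (q - q')" using qk(1) q'p(1) by (simp add: hom_simps)
  ultimately show "x \<in> (\<lambda>y. y - Q y) ` range (P \<circ> Q)" by blast
next
  fix x assume "x \<in> (\<lambda>y. y - Q y) ` range (P \<circ> Q)"
  then obtain z where x: "x = P (Q z) - Q (P (Q z))" by auto
  \<comment> \<open>This sum is \<open>x\<close> with \<open>Q z\<close> added and
    subtracted.\<close>
  have "Q (z - P (Q z)) + (P (Q z) - Q z) \<in> range Q + ker P"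
    by (intro set_plus_intro rangeI) (simp add: mem_ker hom_simps)
  moreover have "Q (- P (Q z)) + P (Q z) \<in> range Q + range P"
    by (rule set_plus_intro) auto
  ultimately show "x \<in> ker Q \<inter> (range Q + ker P) \<inter> (range Q + range P)"
    using x by (simp add: mem_ker hom_simps)
qed

text \<open>For \<open>y = P (Q z)\<close>, idempotence gives \<open>P (Q y) = y = P y\<close>, so
  \<open>P\<close> and \<open>Q\<close> both kill \<open>y - Q y\<close>. Conversely,
  \<open>Q\<close> extracts \<open>q\<close> from \<open>P (Q x) = q + k\<close>, and
  \<open>P q = P (Q x)\<close>.\<close>

lemma comp_idem_iff_rangeP:
  "(\<forall>x. P (Q (P (Q x))) = P (Q x)) \<longleftrightarrow>
    range P \<inter> (range Q + ker P) \<subseteq> range Q + (ker P \<inter> ker Q)"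
  unfolding rangeP_inter_eq
proof (intro iffI allI subsetI)
  fix y assume idem: "\<forall>x. P (Q (P (Q x))) = P (Q x)" and "y \<in> range (P \<circ> Q)"
  then obtain z where "y = P (Q z)" by auto
  then have "P (Q y) = y" "P y = y" using idem by simp_all
  then have "Q y + (y - Q y) \<in> range Q + (ker P \<inter> ker Q)"
    by (intro set_plus_intro) (auto simp: mem_ker hom_simps)
  then show "y \<in> range Q + (ker P \<inter> ker Q)" by simp
next
  fix x assume "range (P \<circ> Q) \<subseteq> range Q + (ker P \<inter> ker Q)"
  then have "P (Q x) \<in> range Q + (ker P \<inter> ker Q)" by auto
  then obtain q k where d: "Q q = q" "P k = 0" "Q k = 0" "P (Q x) = q + k"
    by (auto simp: subspace_simps elim!: set_plus_elim)
  then have "Q (P (Q x)) = q" by (simp add: hom_simps)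
  moreover have "P q = P (Q x)" using d by (metis P.add P_idem add.right_neutral)
  ultimately show "P (Q (P (Q x))) = P (Q x)" by simp
qed

lemma comp_idem_iff_rangeQ:
  "(\<forall>x. P (Q (P (Q x))) = P (Q x)) \<longleftrightarrow>
    range Q \<subseteq> range P + (ker P \<inter> range Q) + (ker P \<inter> ker Q)"
proof (intro iffI allI subsetI)
  fix q assume idem: "\<forall>x. P (Q (P (Q x))) = P (Q x)" and "q \<in> range Q"
  then have q: "Q q = q" by (simp add: range_Q)
  then have "P (Q (P q)) = P q" using idem by metis
  \<comment> \<open>The remainder \<open>q - P q\<close> lies in \<open>ker P\<close> and is split
    by \<open>Q\<close>. Its \<open>Q\<close>-part stays in \<open>ker P\<close> because
    \<open>P (Q q) - P (Q (P q)) = P q - P q = 0\<close>.\<close>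
  with q have "P q + Q (q - P q) + ((q - P q) - Q (q - P q))
      \<in> range P + (ker P \<inter> range Q) + (ker P \<inter> ker Q)"
    by (intro set_plus_intro IntI rangeI) (auto simp: mem_ker hom_simps)
  then show "q \<in> range P + (ker P \<inter> range Q) + (ker P \<inter> ker Q)"
    by (simp add: algebra_simps)
next
  fix x assume "range Q \<subseteq> range P + (ker P \<inter> range Q) + (ker P \<inter> ker Q)"
  then have "Q x \<in> range P + (ker P \<inter> range Q) + (ker P \<inter> ker Q)" by auto
  then obtain p a b where d: "P p = p" "P a = 0" "Q a = a" "P b = 0" "Q b = 0"
      "Q x = p + a + b"
    by (auto simp: subspace_simps elim!: set_plus_elim)
  have "P (Q x) = p" using d by (simp add: hom_simps)
  \<comment> \<open>\<open>P\<close> has identified \<open>p\<close> as \<open>P (Q x)\<close>;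
    applying \<open>Q\<close> and then \<open>P\<close> also removes \<open>b\<close> and
    \<open>a\<close>.\<close>
  moreover have "Q p + a = Q x" using arg_cong[OF d(6), of Q] d(3,5) by (simp add: hom_simps)
  then have "P (Q p) = P (Q x)" using d(2) by (metis P.add add.right_neutral)
  ultimately show "P (Q (P (Q x))) = P (Q x)" by simp
qed

text \<open>For \<open>k = Q x - P (Q x)\<close>, the vector \<open>P (Q k)\<close> is the defect
  \<open>P (Q x) - P (Q (P (Q x)))\<close>. In any decomposition \<open>k = n + a\<close> as on the
  right, \<open>a = Q k\<close>, so \<open>P a = 0\<close> makes the defect vanish.\<close>

lemma comp_idem_iff_kerP:
  "(\<forall>x. P (Q (P (Q x))) = P (Q x)) \<longleftrightarrow>
    ker P \<inter> (range Q + range P) \<subseteq> ker Q + (ker P \<inter> range Q)"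
  unfolding kerP_inter_eq
proof (intro iffI allI subsetI)
  fix k assume idem: "\<forall>x. P (Q (P (Q x))) = P (Q x)" and "k \<in> (\<lambda>q. q - P q) ` range Q"
  then obtain x where "k = Q x - P (Q x)" by auto
  with idem have "P (Q k) = 0" by (simp add: hom_simps)
  then have "(k - Q k) + Q k \<in> ker Q + (ker P \<inter> range Q)"
    by (intro set_plus_intro) (auto simp: mem_ker hom_simps)
  then show "k \<in> ker Q + (ker P \<inter> range Q)" by simp
next
  fix x assume "(\<lambda>q. q - P q) ` range Q \<subseteq> ker Q + (ker P \<inter> range Q)"
  then have "Q x - P (Q x) \<in> ker Q + (ker P \<inter> range Q)" by auto
  then obtain n a where d: "Q n = 0" "P a = 0" "Q a = a" "Q x - P (Q x) = n + a"
    by (auto simp: subspace_simps elim!: set_plus_elim)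
  have "Q x - Q (P (Q x)) = a" using arg_cong[OF d(4), of Q] d(1,3) by (simp add: hom_simps)
  then have "P (Q x) - P (Q (P (Q x))) = 0" using d(2) by (metis P.diff)
  then show "P (Q (P (Q x))) = P (Q x)" by simp
qed

text \<open>\<open>P\<close> sends \<open>y - Q y\<close> with \<open>y = P (Q x)\<close> to the
  same defect, so the equivalence holds for each \<open>x\<close> separately.\<close>

lemma comp_idem_iff_kerQ:
  "(\<forall>x. P (Q (P (Q x))) = P (Q x)) \<longleftrightarrow>
    ker Q \<inter> (range Q + ker P) \<inter> (range Q + range P) \<subseteq> ker P"
proof -
  have "P (Q (P (Q x))) = P (Q x) \<longleftrightarrow> P (Q x) - Q (P (Q x)) \<in> ker P" for x
    unfolding mem_ker P.diff P_idem by (metis right_minus_eq)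
  then show ?thesis
    unfolding kerQ_inter_eq by (simp only: image_subset_iff) (simp only: ball_simps comp_apply)
qed

end

lemma projector_comp_iff:
  assumes "projector scale P" and "projector scale Q"
  shows "projector scale (P \<circ> Q) \<longleftrightarrow> (\<forall>x. P (Q (P (Q x))) = P (Q x))"
  using assms Vector_Spaces.linear_compose[of scale scale Q scale P]
  by (auto simp: projector_def fun_eq_iff)

lemma projector_additive:
  assumes "projector scale P"
  shows "additive P"
proof -
  interpret Vector_Spaces.linear scale scale P
    using assms by (simp add: projector_def)
  show ?thesis by unfold_locales (rule add)
qed

text \<open>Directness of the three sums holds unconditionally, so it is asserted separately and the
  inclusions use plain sums. Each of the four inclusions is compared with the first statement, which
  yields all equivalences.\<close>

theorem theorem7:
  fixes scale :: "'a::field \<Rightarrow> 'b::ab_group_add \<Rightarrow> 'b"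
    and P Q :: "'b \<Rightarrow> 'b"
  assumes "vector_space scale"
    and "projector scale P"
    and "projector scale Q"
  shows
    "direct [range Q, ker P \<inter> ker Q] \<and>
     direct [range P, ker P \<inter> range Q, ker P \<inter> ker Q] \<and>
     direct [ker Q, ker P \<inter> range Q] \<and>
     (projector scale (P \<circ> Q) \<longleftrightarrow>
        range P \<inter> (range Q + ker P) \<subseteq> range Q + (ker P \<inter> ker Q)) \<and>
     (projector scale (P \<circ> Q) \<longleftrightarrow>
        range Q \<subseteq> range P + (ker P \<inter> range Q) + (ker P \<inter> ker Q)) \<and>
     (projector scale (P \<circ> Q) \<longleftrightarrow>
        ker Q + (ker P \<inter> range Q) \<supseteq> ker P \<inter> (range Q + range P)) \<and>
     (projector scale (P \<circ> Q) \<longleftrightarrow>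
        ker P \<supseteq> ker Q \<inter> (range Q + ker P) \<inter> (range Q + range P))"
proof -
  have "P (P x) = P x" "Q (Q x) = Q x" for x
    using assms(2,3) by (simp_all add: projector_def fun_eq_iff)
  then interpret additive_idempotents P Q
    using projector_additive[OF assms(2)] projector_additive[OF assms(3)]
    by (simp add: additive_idempotents_def additive_idempotents_axioms_def)
  show ?thesis
    using direct_rangeQ_kers direct_rangeP_inter_kers direct_kerQ_inter
      comp_idem_iff_rangeP comp_idem_iff_rangeQ comp_idem_iff_kerP comp_idem_iff_kerQ
    by (simp only: projector_comp_iff[OF assms(2,3)])
qed

end
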